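(* Let $\{(x_i,y_i)\}_{i=1}^5$ be a configuration in $\mathbb{P}^2\times\mathbb{P}^2$ and let $Z_5$ be the $5\times 9$ matrix with rows $x_i^\top\otimes y_i^\top$. Then $Z_5$ is rank deficient (i.e. $\operatorname{rank}(Z_5)<5$) if and only if either one of the inherited conditions holds, or, up to interchanging the roles of the $x$'s and the $y$'s, the points $y_1,\dots,y_5$ are on a line and the bracket equations $$[i_1i_3j]_x[i_2i_4j]_x[i_1i_4]_y[i_2i_3]_y=[i_1i_4j]_x[i_2i_3j]_x[i_1i_3]_y[i_2i_4]_y$$ hold for all distinct $i_1,i_2,i_3,i_4,j\in\{1,2,3,4,5\}$. By the action of permutations, there are only $5$ of these equations to consider, one for each choice of $j\in\{1,\dots,5\}$. In the case that both the $x_i$'s and the $y_i$'s are contained in lines, the bracket equations hold automatically. Generically (no three of the $x_i$ collinear and the collinear points $y_i$ distinct), the bracket equations are equivalent to the cross-ratio equalities $$(x_{i_1},x_{i_2};x_{i_3},x_{i_4};x_j)=(y_{i_1},y_{i_2};y_{i_3},y_{i_4})$$ for all distinct $i_1,i_2,i_3,i_4,j\in\{1,2,3,4,5\}$.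
   Context: $\mathbb{P}^n$ is projective space over $\mathbb{C}$; points are represented by nonzero column vectors. $\otimes$ is the Kronecker product. An inherited condition holds for $Z_5$ if the rows of $Z_5$ indexed by some proper subset of $\{1,\dots,5\}$ are linearly dependent. For points $p_i\in\mathbb{P}^2$, $[ijl]$ is the determinant of the $3\times3$ matrix with rows $p_i^\top,p_j^\top,p_l^\top$. For points on a line in $\mathbb{P}^2$, $[ij]$ is computed by identifying the line with $\mathbb{P}^1$ (apply a homography taking the line to $\{( *,*,0)\}$ and drop the $0$ coordinate) and setting $[ij]=\det\begin{bmatrix} p_{i1} & p_{i2} \\ p_{j1} & p_{j2} \end{bmatrix}$. Subscripts $x$, $y$ indicate which points are used. The cross-ratio of $p_1,\dots,p_4\in\mathbb{P}^1$ (or on a line) is $(p_1,p_2;p_3,p_4)=\frac{[13][24]}{[14][23]}$, and the planar cross-ratio of $p_1,\dots,p_5\in\mathbb{P}^2$ around $p_5$ is $(p_1,p_2;p_3,p_4;p_5)=\frac{[135][245]}{[145][235]}$. *)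

theory Defs
  imports "HOL-Analysis.Analysis"
begin

text \<open>
  Points of the complex projective plane and line are given by nonzero representatives in
  \<^typ>\<open>complex^3\<close> and \<^typ>\<open>complex^2\<close>. A configuration is a family of representatives
  indexed by the five-element type \<^typ>\<open>5\<close>.
\<close>

definition proj_eq :: "complex^'n \<Rightarrow> complex^'n \<Rightarrow> bool" where
  "proj_eq u v \<longleftrightarrow> (\<exists>c. c \<noteq> 0 \<and> u = c *s v)"

text \<open>The cone over the line with (nonzero) dual coordinates \<open>l\<close>; it also contains \<open>0\<close>.\<close>

definition proj_line :: "complex^3 \<Rightarrow> (complex^3) set" where
  "proj_line l = {v. (\<Sum>k\<in>UNIV. l $ k * v $ k) = 0}"

definition proj_collinear :: "(complex^3) set \<Rightarrow> bool" where
  "proj_collinear S \<longleftrightarrow> (\<exists>l. l \<noteq> 0 \<and> S \<subseteq> proj_line l)"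

text \<open>
  The Kronecker product, with coordinates indexed by pairs rather than by their
  lexicographic enumeration.
\<close>

definition kronecker :: "complex^'m \<Rightarrow> complex^'n \<Rightarrow> complex^('m \<times> 'n)" where
  "kronecker u v = (\<chi> k. u $ fst k * v $ snd k)"

definition Z_matrix :: "(5 \<Rightarrow> complex^3) \<Rightarrow> (5 \<Rightarrow> complex^3) \<Rightarrow> complex^(3 \<times> 3)^5" where
  "Z_matrix x y = (\<chi> i. kronecker (x i) (y i))"

text \<open>
  Dependence of rows is dependence of the indexed family: two equal rows are dependent, which
  \<^const>\<open>vec.dependent\<close> applied to the set of rows would not see.
\<close>

definition rows_dependent :: "complex^'n^'m \<Rightarrow> 'm set \<Rightarrow> bool" where
  "rows_dependent A S \<longleftrightarrow>
     (\<exists>c. (\<exists>i\<in>S. c i \<noteq> 0) \<and> (\<Sum>i\<in>S. c i *s row i A) = 0)"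

definition inherited_condition :: "complex^'n^'m \<Rightarrow> bool" where
  "inherited_condition A \<longleftrightarrow> (\<exists>S. S \<subset> UNIV \<and> rows_dependent A S)"

definition bracket3 :: "complex^3 \<Rightarrow> complex^3 \<Rightarrow> complex^3 \<Rightarrow> complex" where
  "bracket3 u v w = det (vector [u, v, w] :: complex^3^3)"

definition bracket2 :: "complex^2 \<Rightarrow> complex^2 \<Rightarrow> complex" where
  "bracket2 u v = det (vector [u, v] :: complex^2^2)"

text \<open>
  \<open>H\<close> is (a matrix of) a homography taking some line through the points of \<open>S\<close> to the line of
  points with vanishing third coordinate. The line is unique unless all points of \<open>S\<close> coincide.
\<close>

definition line_chart :: "complex^3^3 \<Rightarrow> (complex^3) set \<Rightarrow> bool" where
  "line_chart H S \<longleftrightarrow> invertible H \<and>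
     (\<exists>l. l \<noteq> 0 \<and> S \<subseteq> proj_line l \<and> (*v) H ` proj_line l = {v. v $ 3 = 0})"

definition to_P1 :: "complex^3^3 \<Rightarrow> complex^3 \<Rightarrow> complex^2" where
  "to_P1 H p = vector [(H *v p) $ 1, (H *v p) $ 2]"

lemma line_chart_exists:
  assumes "proj_collinear S"
  shows "\<exists>H. line_chart H S"
proof -
  obtain l where l: "l \<noteq> 0" "S \<subseteq> proj_line l"
    using assms unfolding proj_collinear_def by blast
  have "\<exists>a b. det (vector [a, b, l] :: complex^3^3) \<noteq> 0"
  proof -
    have "l $ 1 \<noteq> 0 \<or> l $ 2 \<noteq> 0 \<or> l $ 3 \<noteq> 0"
      using l(1) by (auto simp: vec_eq_iff forall_3)
    then consider "l $ 1 \<noteq> 0" | "l $ 2 \<noteq> 0" | "l $ 3 \<noteq> 0"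
      by blast
    then show ?thesis
    proof cases
      case 1
      then show ?thesis
        by (intro exI[of _ "vector [0, 1, 0]"] exI[of _ "vector [0, 0, 1]"]) (simp add: det_3)
    next
      case 2
      then show ?thesis
        by (intro exI[of _ "vector [1, 0, 0]"] exI[of _ "vector [0, 0, 1]"]) (simp add: det_3)
    next
      case 3
      then show ?thesis
        by (intro exI[of _ "vector [1, 0, 0]"] exI[of _ "vector [0, 1, 0]"]) (simp add: det_3)
    qed
  qed
  then obtain a b where ab: "det (vector [a, b, l] :: complex^3^3) \<noteq> 0"
    by blast
  define H :: "complex^3^3" where "H = vector [a, b, l]"
  have inv: "invertible H"
    using ab by (simp add: H_def invertible_det_nz)
  have third: "(H *v v) $ 3 = (\<Sum>k\<in>UNIV. l $ k * v $ k)" for v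
    by (simp add: H_def matrix_vector_mult_def)
  have "(*v) H ` proj_line l = {v. v $ 3 = 0}"
  proof (intro equalityI subsetI)
    fix w :: "complex^3" assume w: "w \<in> {v. v $ 3 = 0}"
    obtain B where B: "H ** B = mat 1"
      using inv unfolding invertible_def by blast
    have "H *v (B *v w) = w"
      by (simp add: matrix_vector_mul_assoc B)
    moreover from this have "B *v w \<in> proj_line l"
      using w third[of "B *v w"] by (simp add: proj_line_def)
    ultimately show "w \<in> (*v) H ` proj_line l"
      by (metis image_eqI)
  qed (auto simp: third proj_line_def)
  then show ?thesis
    unfolding line_chart_def using inv l by blast
qed

text \<open>
  The equation for representatives \<open>x\<close> in the plane and \<open>y\<close> on a line with chart \<open>H\<close>. It is
  homogeneous of the same degree on both sides in each \<open>x i\<close> and \<open>y i\<close>.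
\<close>

definition bracket_equation ::
    "(5 \<Rightarrow> complex^3) \<Rightarrow> (5 \<Rightarrow> complex^3) \<Rightarrow> complex^3^3 \<Rightarrow> 5 \<Rightarrow> 5 \<Rightarrow> 5 \<Rightarrow> 5 \<Rightarrow> 5 \<Rightarrow> bool" where
  "bracket_equation x y H i1 i2 i3 i4 j \<longleftrightarrow>
     bracket3 (x i1) (x i3) (x j) * bracket3 (x i2) (x i4) (x j) *
       bracket2 (to_P1 H (y i1)) (to_P1 H (y i4)) * bracket2 (to_P1 H (y i2)) (to_P1 H (y i3)) =
     bracket3 (x i1) (x i4) (x j) * bracket3 (x i2) (x i3) (x j) *
       bracket2 (to_P1 H (y i1)) (to_P1 H (y i3)) * bracket2 (to_P1 H (y i2)) (to_P1 H (y i4))"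

definition all_bracket_equations ::
    "(5 \<Rightarrow> complex^3) \<Rightarrow> (5 \<Rightarrow> complex^3) \<Rightarrow> complex^3^3 \<Rightarrow> bool" where
  "all_bracket_equations x y H \<longleftrightarrow>
     (\<forall>i1 i2 i3 i4 j. distinct [i1, i2, i3, i4, j] \<longrightarrow> bracket_equation x y H i1 i2 i3 i4 j)"

definition cross_ratio ::
    "complex^2 \<Rightarrow> complex^2 \<Rightarrow> complex^2 \<Rightarrow> complex^2 \<Rightarrow> complex" where
  "cross_ratio p1 p2 p3 p4 =
     (bracket2 p1 p3 * bracket2 p2 p4) / (bracket2 p1 p4 * bracket2 p2 p3)"

definition planar_cross_ratio ::
    "complex^3 \<Rightarrow> complex^3 \<Rightarrow> complex^3 \<Rightarrow> complex^3 \<Rightarrow> complex^3 \<Rightarrow> complex" where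
  "planar_cross_ratio p1 p2 p3 p4 p5 =
     (bracket3 p1 p3 p5 * bracket3 p2 p4 p5) / (bracket3 p1 p4 p5 * bracket3 p2 p3 p5)"

end

theory Submission
  imports Defs
begin

text \<open>
  The rank drops exactly when there are coefficients \<open>c\<close>, not all zero, with
  \<open>\<Sum> c i * x i \<otimes> y i = 0\<close>, and an inherited condition is such a relation with some \<open>c i = 0\<close>.
  The whole proof manipulates such relations.

  Suppose first that a relation has no vanishing coefficient. If the \<open>x i\<close> span the plane,
  name the five indices \<open>a, b, c, d, e\<close> so that \<open>x a, x b, x c\<close> form a basis. Comparing coefficients in this
  basis expresses \<open>y a, y b, y c\<close> through \<open>y d, y e\<close>, so all the \<open>y i\<close> lie on one line
  (\<open>collinear_if_relation\<close>). Once they do, a chart turns them into vectors of \<open>\<complex>\<^sup>2\<close>, and the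
  functional \<open>[\<cdot> i3 j]\<^sub>x \<otimes> [\<cdot> i4]\<^sub>y\<close> leaves only the terms \<open>i1\<close> and \<open>i2\<close> of the relation. So does
  the one with \<open>i3\<close> and \<open>i4\<close> exchanged. Two linear equations with the nonzero solution
  \<open>(c i1, c i2)\<close> have determinant zero, and this determinant is the bracket equation
  (\<open>bracket_equations_if_relation\<close>).

  Conversely, let the \<open>y i\<close> be vectors of \<open>\<complex>\<^sup>2\<close> and \<open>x a, x b, x c\<close> a basis. Given the coefficients
  \<open>s, t\<close> of the points \<open>d, e\<close>, a relation exists if, for each \<open>m \<in> {a, b, c}\<close>, the \<open>m\<close>-th
  coordinate of \<open>s * x d \<otimes> y d + t * x e \<otimes> y e\<close> is a multiple of \<open>y m\<close>. That is one linear equation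
  in \<open>(s, t)\<close> for each \<open>m\<close>, and the three \<open>2 \<times> 2\<close> minors of the system are the bracket equations
  for \<open>j = c, b, a\<close>. So the bracket equations provide a nonzero \<open>(s, t)\<close>
  (\<open>relation_if_bracket_equations\<close>). If instead the \<open>x i\<close> are collinear too, the five products
  live in \<open>\<complex>\<^sup>2 \<otimes> \<complex>\<^sup>2\<close>, which has dimension four (\<open>relation_if_both_collinear\<close>).

  The equations with a common \<open>j\<close> agree because both sides are governed by the same
  three-term Pluecker relation: with \<open>j\<close> appended, the planar brackets satisfy it as the brackets
  of the line do (\<open>bracket_equation_swap13\<close>).
\<close>

section \<open>Linear relations between Kronecker products\<close>

definition kronecker_relation ::
    "('i::finite \<Rightarrow> complex) \<Rightarrow> ('i \<Rightarrow> complex^'m) \<Rightarrow> ('i \<Rightarrow> complex^'n) \<Rightarrow> bool" where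
  "kronecker_relation c x y \<longleftrightarrow> (\<forall>k l. (\<Sum>i\<in>UNIV. c i * x i $ k * y i $ l) = 0)"

lemma kronecker_relation_commute: "kronecker_relation c x y \<longleftrightarrow> kronecker_relation c y x"
  unfolding kronecker_relation_def by (subst all_comm) (simp add: mult_ac)

text \<open>
  Applying a product of two linear functionals to a relation is the way in which all scalar
  equations are extracted from it.
\<close>

lemma kronecker_relation_functionals:
  assumes "kronecker_relation c x y"
  shows "(\<Sum>i\<in>UNIV. c i * (\<Sum>k\<in>UNIV. a $ k * x i $ k) * (\<Sum>l\<in>UNIV. b $ l * y i $ l)) = 0"
proof -
  have "(\<Sum>i\<in>UNIV. c i * (\<Sum>k\<in>UNIV. a $ k * x i $ k) * (\<Sum>l\<in>UNIV. b $ l * y i $ l))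
      = (\<Sum>i\<in>UNIV. \<Sum>k\<in>UNIV. \<Sum>l\<in>UNIV. a $ k * b $ l * (c i * x i $ k * y i $ l))"
    by (simp add: sum_distrib_left sum_distrib_right mult_ac)
  also have "\<dots> = (\<Sum>k\<in>UNIV. \<Sum>l\<in>UNIV. \<Sum>i\<in>UNIV. a $ k * b $ l * (c i * x i $ k * y i $ l))"
    by (subst sum.swap, rule sum.cong[OF refl], rule sum.swap)
  also have "\<dots> = 0"
    using assms by (simp add: kronecker_relation_def flip: sum_distrib_left)
  finally show ?thesis .
qed

lemma kronecker_relation_slices:
  "kronecker_relation c x y \<longleftrightarrow> (\<forall>k. (\<Sum>i\<in>UNIV. (c i * x i $ k) *s y i) = 0)"
  by (simp add: kronecker_relation_def vec_eq_iff sum_component)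

lemma rows_dependent_kronecker:
  "rows_dependent (\<chi> i. kronecker (x i) (y i)) UNIV \<longleftrightarrow>
     (\<exists>c. (\<exists>i. c i \<noteq> 0) \<and> kronecker_relation c x y)"
proof -
  have "(\<Sum>i\<in>UNIV. c i *s row i (\<chi> i. kronecker (x i) (y i))) = 0 \<longleftrightarrow> kronecker_relation c x y" for c
    by (simp add: kronecker_relation_def vec_eq_iff sum_component row_def kronecker_def mult.assoc)
  then show ?thesis
    by (simp add: rows_dependent_def)
qed

text \<open>
  \<^const>\<open>rank\<close> measures the set of rows, while \<^const>\<open>rows_dependent\<close> speaks of the family.
  The two fit together because a family that satisfies no relation is injective, so that its range
  is an independent set with as many elements as there are rows.
\<close>

lemma rank_less_iff_rows_dependent:
  fixes A :: "complex^'n^'m"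
  shows "rank A < CARD('m) \<longleftrightarrow> rows_dependent A UNIV"
proof
  assume less: "rank A < CARD('m)"
  show "rows_dependent A UNIV"
  proof (rule ccontr)
    assume "\<not> rows_dependent A UNIV"
    then have indep: "\<And>c. (\<Sum>i\<in>UNIV. c i *s row i A) = 0 \<Longrightarrow> \<forall>i. c i = 0"
      by (auto simp: rows_dependent_def)
    have inj: "inj (\<lambda>i. row i A)"
    proof (rule injI, rule ccontr)
      fix i j assume eq: "row i A = row j A" and "i \<noteq> j"
      \<comment> \<open>Equal rows would give the relation with coefficients \<open>1\<close> and \<open>-1\<close>.\<close>
      have "(\<Sum>m\<in>UNIV. ((if m = i then 1 else 0) - (if m = j then 1 else 0)) *s row m A)
          = row i A - row j A"
        by (simp add: vector_sub_rdistrib sum_subtractf if_distrib[of "\<lambda>c. c *s _"] cong: if_cong)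
      then show False
        using indep[of "\<lambda>m. (if m = i then 1 else 0) - (if m = j then 1 else 0)"] eq \<open>i \<noteq> j\<close>
        by (auto dest!: spec[of _ i])
    qed
    have rows: "rows A = range (\<lambda>i. row i A)"
      by (auto simp: rows_def)
    have "vec.independent (rows A)"
    proof (subst vec.dependent_finite)
      show "finite (rows A)" by (simp add: rows)
      show "\<not> (\<exists>u. (\<exists>v\<in>rows A. u v \<noteq> 0) \<and> (\<Sum>v\<in>rows A. u v *s v) = 0)"
      proof
        assume "\<exists>u. (\<exists>v\<in>rows A. u v \<noteq> 0) \<and> (\<Sum>v\<in>rows A. u v *s v) = 0"
        then obtain u i where "u (row i A) \<noteq> 0" "(\<Sum>v\<in>rows A. u v *s v) = 0"
          by (auto simp: rows)
        moreover from this(2) have "(\<Sum>i\<in>UNIV. u (row i A) *s row i A) = 0"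
          by (simp add: rows sum.reindex[OF inj])
        ultimately show False
          using indep[of "\<lambda>i. u (row i A)"] by simp
      qed
    qed
    then have "rank A = CARD('m)"
      by (simp add: row_rank_def_gen vec.dim_eq_card_independent rows card_image[OF inj])
    with less show False by simp
  qed
next
  assume "rows_dependent A UNIV"
  then obtain c i0 where c: "c i0 \<noteq> 0" "(\<Sum>i\<in>UNIV. c i *s row i A) = 0"
    by (auto simp: rows_dependent_def)
  let ?B = "(\<lambda>i. row i A) ` (UNIV - {i0})"
  have "c i0 *s row i0 A = (\<Sum>i\<in>UNIV - {i0}. (- c i) *s row i A)"
    using c(2) by (simp add: sum.remove[of UNIV i0] sum_negf add_eq_0_iff)
  also have "\<dots> \<in> vec.span ?B"
    by (intro vec.span_sum vec.span_scale vec.span_base) auto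
  finally have "row i0 A \<in> vec.span ?B"
    using vec.span_scale[of "c i0 *s row i0 A" ?B "inverse (c i0)"] c(1) by simp
  then have "rows A \<subseteq> vec.span ?B"
    by (auto simp: rows_def intro: vec.span_base)
  then have "rank A \<le> card ?B"
    by (simp add: row_rank_def_gen vec.dim_le_card)
  also have "\<dots> \<le> card (UNIV - {i0})"
    by (rule card_image_le) simp
  also have "\<dots> < CARD('m)"
    by (rule psubset_card_mono) auto
  finally show "rank A < CARD('m)" .
qed

lemma rank_le_ncols: "rank (A :: complex^'n^'m) \<le> CARD('n)"
  unfolding row_rank_def_gen by (metis vec.dim_subset_UNIV vec.dimension_def card_cart_basis)

text \<open>
  Extending a relation by zero, or restricting it to its support, trades a proper subset of the rows
  for a vanishing coefficient.
\<close>

lemma inherited_condition_kronecker: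
  "inherited_condition (\<chi> i. kronecker (x i) (y i)) \<longleftrightarrow>
     (\<exists>c. (\<exists>i. c i \<noteq> 0) \<and> (\<exists>i. c i = 0) \<and> kronecker_relation c x y)"
  (is "?L \<longleftrightarrow> ?R")
proof
  assume ?L
  then obtain S c i where S: "S \<subset> UNIV" "i \<in> S" "c i \<noteq> 0"
      "(\<Sum>i\<in>S. c i *s row i (\<chi> i. kronecker (x i) (y i))) = 0"
    by (auto simp: inherited_condition_def rows_dependent_def)
  define d where "d = (\<lambda>i. if i \<in> S then c i else 0)"
  have "(\<Sum>i\<in>UNIV. d i * x i $ k * y i $ l) = (\<Sum>i\<in>S. c i * x i $ k * y i $ l)" for k l
    by (rule sum.mono_neutral_cong_right) (auto simp: d_def)
  moreover have "(\<Sum>i\<in>S. c i * x i $ k * y i $ l) = 0" for k l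
    using S(4) by (simp add: vec_eq_iff sum_component row_def kronecker_def mult.assoc)
  ultimately have "kronecker_relation d x y"
    by (simp add: kronecker_relation_def)
  moreover have "d i \<noteq> 0" "\<exists>i. d i = 0"
    using S by (auto simp: d_def)
  ultimately show ?R by blast
next
  assume ?R
  then obtain c i j where c: "c i \<noteq> 0" "c j = 0" "kronecker_relation c x y" by blast
  have "(\<Sum>i\<in>{i. c i \<noteq> 0}. c i * x i $ k * y i $ l) = (\<Sum>i\<in>UNIV. c i * x i $ k * y i $ l)" for k l
    by (rule sum.mono_neutral_left) auto
  with c(3) have "(\<Sum>i\<in>{i. c i \<noteq> 0}. c i *s row i (\<chi> i. kronecker (x i) (y i))) = 0"
    by (simp add: kronecker_relation_def vec_eq_iff sum_component row_def kronecker_def mult.assoc)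
  with c(1) have "rows_dependent (\<chi> i. kronecker (x i) (y i)) {i. c i \<noteq> 0}"
    by (auto simp: rows_dependent_def)
  with c(2) show ?L
    unfolding inherited_condition_def by (intro exI[of _ "{i. c i \<noteq> 0}"]) auto
qed

section \<open>Brackets\<close>

lemma bracket3_expand:
  "bracket3 u v w = u $ 1 * v $ 2 * w $ 3 + u $ 2 * v $ 3 * w $ 1 + u $ 3 * v $ 1 * w $ 2
    - u $ 1 * v $ 3 * w $ 2 - u $ 2 * v $ 1 * w $ 3 - u $ 3 * v $ 2 * w $ 1"
  by (simp add: bracket3_def det_3)

lemma bracket2_expand: "bracket2 u v = u $ 1 * v $ 2 - u $ 2 * v $ 1"
  by (simp add: bracket2_def det_2)

lemma bracket3_repeated [simp]:
  "bracket3 u u w = 0" "bracket3 u v u = 0" "bracket3 u v v = 0"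
  by (simp_all add: bracket3_expand)

lemma bracket2_self [simp]: "bracket2 u u = 0"
  by (simp add: bracket2_expand)

definition cross :: "complex^3 \<Rightarrow> complex^3 \<Rightarrow> complex^3" where
  "cross v w = vector [v $ 2 * w $ 3 - v $ 3 * w $ 2, v $ 3 * w $ 1 - v $ 1 * w $ 3,
     v $ 1 * w $ 2 - v $ 2 * w $ 1]"

text \<open>
  Brackets are linear functionals of their first argument, which makes
  \<open>kronecker_relation_functionals\<close> applicable to them.
\<close>

lemma bracket3_functional: "bracket3 u v w = (\<Sum>k\<in>UNIV. cross v w $ k * u $ k)"
  by (simp add: bracket3_expand cross_def sum_3 algebra_simps)

lemma bracket2_functional: "bracket2 u v = (\<Sum>k\<in>UNIV. (vector [v $ 2, - v $ 1] :: complex^2) $ k * u $ k)"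
  by (simp add: bracket2_expand sum_2 algebra_simps)

lemma kronecker_relation_brackets:
  assumes "kronecker_relation c x y"
  shows "(\<Sum>i\<in>UNIV. c i * bracket3 (x i) u v * bracket2 (y i) w) = 0"
  unfolding bracket3_functional bracket2_functional
  by (rule kronecker_relation_functionals[OF assms])

lemma bracket3_cramer:
  "bracket3 u v w *s p = bracket3 p v w *s u + bracket3 p w u *s v + bracket3 p u v *s w"
  by (simp add: vec_eq_iff forall_3 bracket3_expand algebra_simps)

lemma parallel_if_bracket2_zero:
  assumes "bracket2 u v = 0" "v \<noteq> 0"
  obtains t where "u = t *s v"
proof (cases "v $ 1 = 0")
  case True
  then have "v $ 2 \<noteq> 0" using assms(2) by (auto simp: vec_eq_iff forall_2)
  with True assms(1) have "u = (u $ 2 / v $ 2) *s v"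
    by (auto simp: vec_eq_iff forall_2 bracket2_expand)
  then show ?thesis by (rule that)
next
  case False
  with assms(1) have "u = (u $ 1 / v $ 1) *s v"
    by (auto simp: vec_eq_iff forall_2 bracket2_expand field_simps)
  then show ?thesis by (rule that)
qed

lemma annihilator_of_two_exists:
  fixes u v :: "complex^3"
  obtains l where "l \<noteq> 0" "(\<Sum>k\<in>UNIV. l $ k * u $ k) = 0" "(\<Sum>k\<in>UNIV. l $ k * v $ k) = 0"
proof -
  have "det (vector [u, v, v] :: complex^3^3) = 0"
    by (simp add: det_3)
  then have "\<not> invertible (vector [u, v, v] :: complex^3^3)"
    by (simp add: invertible_det_nz)
  then obtain l where "l \<noteq> 0" "(vector [u, v, v] :: complex^3^3) *v l = 0"
    unfolding invertible_left_inverse matrix_left_invertible_ker by blast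
  then show ?thesis
    by (intro that[of l])
      (auto simp: matrix_vector_mult_def vec_eq_iff forall_3 mult.commute)
qed

text \<open>
  If two of the points are distinct, the coordinates of the line joining them are their cross product,
  and a third point is on that line when the bracket of the three vanishes.
\<close>

lemma proj_collinear_iff_brackets:
  "proj_collinear S \<longleftrightarrow> (\<forall>u\<in>S. \<forall>v\<in>S. \<forall>w\<in>S. bracket3 u v w = 0)"
proof
  assume "proj_collinear S"
  then obtain l where l: "l \<noteq> 0" "S \<subseteq> proj_line l"
    by (auto simp: proj_collinear_def)
  show "\<forall>u\<in>S. \<forall>v\<in>S. \<forall>w\<in>S. bracket3 u v w = 0"
  proof (intro ballI)
    fix u v w assume "u \<in> S" "v \<in> S" "w \<in> S"
    with l(2) have "(vector [u, v, w] :: complex^3^3) *v l = 0"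
      by (auto simp: matrix_vector_mult_def vec_eq_iff forall_3 proj_line_def subset_iff
          mult.commute[of "l $ _"])
    with l(1) have "\<not> invertible (vector [u, v, w] :: complex^3^3)"
      unfolding invertible_left_inverse matrix_left_invertible_ker by blast
    then show "bracket3 u v w = 0"
      by (simp add: bracket3_def invertible_det_nz)
  qed
next
  assume zero: "\<forall>u\<in>S. \<forall>v\<in>S. \<forall>w\<in>S. bracket3 u v w = 0"
  show "proj_collinear S"
  proof (cases "\<exists>v\<in>S. \<exists>w\<in>S. cross v w \<noteq> 0")
    case True
    then obtain v w where "v \<in> S" "w \<in> S" "cross v w \<noteq> 0" by blast
    with zero show ?thesis
      unfolding proj_collinear_def proj_line_def
      by (intro exI[of _ "cross v w"]) (auto simp flip: bracket3_functional)
  next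
    case False
    \<comment> \<open>All points are multiples of one vector, so any line through that vector will do.\<close>
    show ?thesis
    proof (cases "S \<subseteq> {0}")
      case True
      then show ?thesis
        by (auto simp: proj_collinear_def proj_line_def intro!: exI[of _ "axis 1 1"])
    next
      case nz: False
      then obtain v where v: "v \<in> S" "v \<noteq> 0" by auto
      obtain l where l: "l \<noteq> 0" "(\<Sum>k\<in>UNIV. l $ k * v $ k) = 0"
        using annihilator_of_two_exists[of v v] by blast
      have "w \<in> proj_line l" if "w \<in> S" for w
      proof -
        have "cross v w = 0" using False v(1) that by blast
        then have par: "v $ m * w $ k = v $ k * w $ m" for m k
          using exhaust_3[of m] exhaust_3[of k]
          by (auto simp: cross_def vec_eq_iff forall_3)
        obtain m where m: "v $ m \<noteq> 0" using v(2) by (auto simp: vec_eq_iff)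
        have "v $ m * (\<Sum>k\<in>UNIV. l $ k * w $ k) = (\<Sum>k\<in>UNIV. l $ k * (v $ m * w $ k))"
          by (simp add: sum_distrib_left mult_ac)
        also have "\<dots> = (\<Sum>k\<in>UNIV. l $ k * v $ k) * w $ m"
          by (simp add: par[of m] sum_distrib_right mult.assoc)
        finally show ?thesis using l(2) m by (simp add: proj_line_def)
      qed
      with l(1) show ?thesis by (auto simp: proj_collinear_def)
    qed
  qed
qed

lemma bracket3_nonzero_if_not_collinear:
  assumes "\<not> proj_collinear {u, v, w}"
  shows "bracket3 u v w \<noteq> 0"
proof
  assume zero: "bracket3 u v w = 0"
  have "bracket3 v w u = bracket3 u v w" "bracket3 w u v = bracket3 u v w"
       "bracket3 v u w = - bracket3 u v w" "bracket3 u w v = - bracket3 u v w"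
       "bracket3 w v u = - bracket3 u v w"
    by (simp_all add: bracket3_expand algebra_simps)
  with zero have "proj_collinear {u, v, w}"
    by (simp add: proj_collinear_iff_brackets)
  with assms show False ..
qed

section \<open>Charts of a line\<close>

text \<open>
  Linear relations survive the passage to the chart: the homography is an injective linear map, and
  the coordinate dropped afterwards is zero on the line.
\<close>

lemma line_chart_sum_zero_iff:
  assumes "line_chart H S" "\<And>i. v i \<in> S"
  shows "(\<Sum>i\<in>I. c i *s v i) = 0 \<longleftrightarrow> (\<Sum>i\<in>I. c i *s to_P1 H (v i)) = 0"
proof -
  have third: "(H *v v i) $ 3 = 0" for i
    using assms unfolding line_chart_def by blast
  have inj: "H *v w = 0 \<longleftrightarrow> w = 0" for w
    using assms(1) unfolding line_chart_def invertible_left_inverse matrix_left_invertible_ker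
    by (metis matrix_vector_mult_0_right)
  have "(\<Sum>i\<in>I. c i *s v i) = 0 \<longleftrightarrow> (\<Sum>i\<in>I. c i *s (H *v v i)) = 0"
    by (subst inj[symmetric]) (simp add: vec.linear_sum[OF matrix_vector_mul_linear_gen] vector_scalar_commute)
  also have "\<dots> \<longleftrightarrow> (\<Sum>i\<in>I. c i *s to_P1 H (v i)) = 0"
    by (simp add: vec_eq_iff forall_2 forall_3 sum_component to_P1_def third)
  finally show ?thesis .
qed

lemma to_P1_nonzero:
  assumes "line_chart H S" "p \<in> S" "p \<noteq> 0"
  shows "to_P1 H p \<noteq> 0"
  using line_chart_sum_zero_iff[OF assms(1), of "\<lambda>_. p" "\<lambda>_. 1" "{()}"] assms by simp

lemma bracket2_to_P1_nonzero:
  assumes "line_chart H S" "p \<in> S" "q \<in> S" "p \<noteq> 0" "q \<noteq> 0" "\<not> proj_eq p q"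
  shows "bracket2 (to_P1 H p) (to_P1 H q) \<noteq> 0"
proof
  assume "bracket2 (to_P1 H p) (to_P1 H q) = 0"
  then obtain t where "to_P1 H p = t *s to_P1 H q"
    by (rule parallel_if_bracket2_zero) (use assms to_P1_nonzero in blast)
  \<comment> \<open>The proportionality is a relation between two vectors, indexed here by \<^typ>\<open>bool\<close>.\<close>
  then have "(\<Sum>b\<in>UNIV. (if b then 1 else - t) *s (if b then p else q)) = 0"
    by (subst line_chart_sum_zero_iff[OF assms(1)]) (auto simp: assms UNIV_bool)
  then have "p = t *s q"
    by (simp add: UNIV_bool)
  with assms show False
    unfolding proj_eq_def by (metis vector_smult_lzero)
qed

lemma kronecker_relation_chart:
  assumes "line_chart H (range y)"
  shows "kronecker_relation c x y \<longleftrightarrow> kronecker_relation c x (\<lambda>i. to_P1 H (y i))"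
  unfolding kronecker_relation_slices using assms by (simp add: line_chart_sum_zero_iff[OF assms])

section \<open>Bracket equations and relations among five points\<close>

lemma complete_distinct_triple:
  fixes a b c :: 5
  assumes "distinct [a, b, c]"
  obtains d e where "distinct [a, b, c, d, e]" "UNIV = {a, b, c, d, e}"
proof -
  have "card (UNIV - {a, b, c}) = 2"
    using assms by (simp add: card_Diff_subset)
  then obtain d e where "UNIV - {a, b, c} = {d, e}" "d \<noteq> e"
    by (auto simp: card_2_iff)
  with assms show ?thesis
    by (intro that[of d e]) auto
qed

lemma distinct_five_UNIV:
  fixes a b c d e :: 5
  assumes "distinct [a, b, c, d, e]"
  shows "UNIV = {a, b, c, d, e}"
  by (rule sym, rule card_subset_eq) (use assms in simp_all)

lemma sum_five:
  fixes a b c d e :: 5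
  assumes "distinct [a, b, c, d, e]"
  shows "sum f UNIV = f a + f b + f c + f d + f e"
  unfolding distinct_five_UNIV[OF assms] using assms by (simp add: add.assoc)

text \<open>
  With \<open>j\<close> fixed, bracketing \<open>x\<close> with \<open>x i3, x j\<close> and \<open>y\<close> with \<open>y i4\<close> annihilates the three terms
  other than \<open>i1, i2\<close>. Exchanging \<open>i3\<close> and \<open>i4\<close> gives a second equation in \<open>c i1, c i2\<close>, and
  eliminating \<open>c i2\<close> leaves \<open>c i1\<close> times the bracket equation.
\<close>

lemma bracket_equations_if_relation:
  assumes rel: "kronecker_relation c x (\<lambda>i. to_P1 H (y i))"
    and nz: "\<And>i. c i \<noteq> 0"
  shows "all_bracket_equations x y H"
  unfolding all_bracket_equations_def
proof (intro allI impI)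
  fix i1 i2 i3 i4 j :: 5
  assume dist: "distinct [i1, i2, i3, i4, j]"
  define Q where "Q = (\<lambda>m n. bracket2 (to_P1 H (y m)) (to_P1 H (y n)))"
  define P where "P = (\<lambda>m n. bracket3 (x m) (x n) (x j))"
  have 1: "c i1 * P i1 i3 * Q i1 i4 + c i2 * P i2 i3 * Q i2 i4 = 0"
    using kronecker_relation_brackets[OF rel, of "x i3" "x j" "to_P1 H (y i4)"]
    by (simp add: sum_five[OF dist] P_def Q_def)
  have 2: "c i1 * P i1 i4 * Q i1 i3 + c i2 * P i2 i4 * Q i2 i3 = 0"
    using kronecker_relation_brackets[OF rel, of "x i4" "x j" "to_P1 H (y i3)"]
    by (simp add: sum_five[OF dist] P_def Q_def)
  have "c i1 * (P i1 i3 * P i2 i4 * Q i1 i4 * Q i2 i3 - P i1 i4 * P i2 i3 * Q i1 i3 * Q i2 i4) = 0"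
    using 1 2 by algebra
  then show "bracket_equation x y H i1 i2 i3 i4 j"
    using nz[of i1] by (simp add: bracket_equation_def P_def Q_def)
qed

text \<open>
  A matrix with two columns \<open>f, g\<close> and vanishing \<open>2 \<times> 2\<close> minors has a nontrivial kernel: it is
  spanned by the vector orthogonal to any nonzero row.
\<close>

lemma common_kernel_if_minors_zero:
  fixes f g :: "'i \<Rightarrow> complex"
  assumes "\<And>k m. k \<in> I \<Longrightarrow> m \<in> I \<Longrightarrow> f k * g m = f m * g k"
  obtains s t where "s \<noteq> 0 \<or> t \<noteq> 0" "\<And>k. k \<in> I \<Longrightarrow> s * f k + t * g k = 0"
proof (cases "\<exists>m\<in>I. f m \<noteq> 0 \<or> g m \<noteq> 0")
  case True
  then obtain m where "m \<in> I" "f m \<noteq> 0 \<or> g m \<noteq> 0" by blast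
  then show ?thesis
    using assms by (intro that[of "g m" "- f m"]) (auto simp: mult.commute)
next
  case False
  then show ?thesis by (intro that[of 1 0]) auto
qed

text \<open>
  Modulo \<open>v\<close>, the planar brackets through \<open>v\<close> are brackets of points of a projective line, hence they
  satisfy the same three-term relation as \<^const>\<open>bracket2\<close>.
\<close>

lemma bracket3_pluecker:
  "bracket3 p q v * bracket3 r s v - bracket3 p r v * bracket3 q s v + bracket3 p s v * bracket3 q r v = 0"
  by (simp add: bracket3_expand algebra_simps)

lemma bracket2_pluecker:
  "bracket2 p q * bracket2 r s - bracket2 p r * bracket2 q s + bracket2 p s * bracket2 q r = 0"
  by (simp add: bracket2_expand algebra_simps)

lemma bracket3_swap: "bracket3 v u w = - bracket3 u v w" "bracket3 u w v = - bracket3 u v w"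
  by (simp_all add: bracket3_expand algebra_simps)

lemma bracket2_swap: "bracket2 v u = - bracket2 u v"
  by (simp add: bracket2_expand)

lemma bracket_equation_swap12:
  "bracket_equation x y H i2 i1 i3 i4 j \<longleftrightarrow> bracket_equation x y H i1 i2 i3 i4 j"
  unfolding bracket_equation_def by (auto simp: mult_ac)

lemma bracket_equation_swap34:
  "bracket_equation x y H i1 i2 i4 i3 j \<longleftrightarrow> bracket_equation x y H i1 i2 i3 i4 j"
  unfolding bracket_equation_def by (auto simp: mult_ac)

text \<open>
  Let \<open>A, B, C\<close> and \<open>A', B', C'\<close> be the products of brackets for the pairings
  \<open>12|34\<close>, \<open>13|24\<close>, \<open>14|23\<close> in \<open>x\<close> and in \<open>y\<close>. The bracket equation is \<open>B * C' = C * B'\<close>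
  and the swapped one is \<open>B * A' = A * B'\<close>. Since \<open>A = B - C\<close> and \<open>A' = B' - C'\<close>, they agree.
\<close>

lemma bracket_equation_swap13:
  "bracket_equation x y H i3 i2 i1 i4 j \<longleftrightarrow> bracket_equation x y H i1 i2 i3 i4 j"
proof -
  define P where "P = (\<lambda>m n. bracket3 (x m) (x n) (x j))"
  define Q where "Q = (\<lambda>m n. bracket2 (to_P1 H (y m)) (to_P1 H (y n)))"
  have P: "P i1 i2 * P i3 i4 - P i1 i3 * P i2 i4 + P i1 i4 * P i2 i3 = 0"
    unfolding P_def by (rule bracket3_pluecker)
  have Q: "Q i1 i2 * Q i3 i4 - Q i1 i3 * Q i2 i4 + Q i1 i4 * Q i2 i3 = 0"
    unfolding Q_def by (rule bracket2_pluecker)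
  have flip: "P i3 i1 = - P i1 i3" "P i2 i1 = - P i1 i2" "P i3 i2 = - P i2 i3"
      "Q i3 i1 = - Q i1 i3" "Q i2 i1 = - Q i1 i2" "Q i3 i2 = - Q i2 i3"
    unfolding P_def Q_def using bracket3_swap(1) bracket2_swap by blast+
  have "P i3 i1 * P i2 i4 * Q i3 i4 * Q i2 i1 - P i3 i4 * P i2 i1 * Q i3 i1 * Q i2 i4
      = - (P i1 i3 * P i2 i4 * Q i1 i4 * Q i2 i3 - P i1 i4 * P i2 i3 * Q i1 i3 * Q i2 i4)"
    using P Q unfolding flip by algebra
  moreover have "bracket_equation x y H k1 k2 k3 k4 j \<longleftrightarrow>
      P k1 k3 * P k2 k4 * Q k1 k4 * Q k2 k3 - P k1 k4 * P k2 k3 * Q k1 k3 * Q k2 k4 = 0" for k1 k2 k3 k4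
    by (simp add: bracket_equation_def P_def Q_def)
  ultimately show ?thesis
    by (simp only: neg_equal_0_iff_equal)
qed

lemma bracket_equation_swap23:
  "bracket_equation x y H i1 i3 i2 i4 j \<longleftrightarrow> bracket_equation x y H i1 i2 i3 i4 j"
  by (metis bracket_equation_swap12 bracket_equation_swap13)

text \<open>
  Adjacent transpositions sort any permutation of \<open>i2, i3, i4\<close>; used as permutative rewrite rules
  they let the simplifier do so.
\<close>

lemma bracket_equation_permute_fixing_first:
  assumes "distinct [i1, i2, i3, i4, j]" "distinct [i1, k2, k3, k4, j]"
  shows "bracket_equation x y H i1 i2 i3 i4 j \<longleftrightarrow> bracket_equation x y H i1 k2 k3 k4 j"
proof -
  have "m \<in> {i1, i2, i3, i4, j}" for m
    using distinct_five_UNIV[OF assms(1)] by blast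
  from this[of k2] this[of k3] this[of k4] have
    "k2 = i2 \<and> (k3 = i3 \<and> k4 = i4 \<or> k3 = i4 \<and> k4 = i3) \<or>
     k2 = i3 \<and> (k3 = i2 \<and> k4 = i4 \<or> k3 = i4 \<and> k4 = i2) \<or>
     k2 = i4 \<and> (k3 = i2 \<and> k4 = i3 \<or> k3 = i3 \<and> k4 = i2)"
    using assms(2) by auto
  then show ?thesis
    by (auto simp: bracket_equation_swap23 bracket_equation_swap34)
qed

lemma bracket_equation_permute:
  assumes "distinct [i1, i2, i3, i4, j]" "distinct [k1, k2, k3, k4, j]"
  shows "bracket_equation x y H i1 i2 i3 i4 j \<longleftrightarrow> bracket_equation x y H k1 k2 k3 k4 j"
proof -
  have "k1 \<in> {i1, i2, i3, i4, j}"
    using distinct_five_UNIV[OF assms(1)] by blast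
  then consider "k1 = i1" | "k1 = i2" | "k1 = i3" | "k1 = i4"
    using assms(2) by auto
  then show ?thesis
  proof cases
    case 1
    with assms show ?thesis
      by (auto intro!: bracket_equation_permute_fixing_first)
  next
    case 2
    have "bracket_equation x y H i2 i1 i3 i4 j \<longleftrightarrow> bracket_equation x y H i2 k2 k3 k4 j"
      using assms 2 by (intro bracket_equation_permute_fixing_first) auto
    with 2 show ?thesis by (simp only: bracket_equation_swap12[of x y H i2 i1])
  next
    case 3
    have "bracket_equation x y H i3 i2 i1 i4 j \<longleftrightarrow> bracket_equation x y H i3 k2 k3 k4 j"
      using assms 3 by (intro bracket_equation_permute_fixing_first) auto
    with 3 show ?thesis by (simp only: bracket_equation_swap13[of x y H i3 i2 i1])
  next
    case 4
    have "bracket_equation x y H i4 i2 i1 i3 j \<longleftrightarrow> bracket_equation x y H i4 k2 k3 k4 j"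
      using assms 4 by (intro bracket_equation_permute_fixing_first) auto
    with 4 show ?thesis
      by (simp only: bracket_equation_swap13[of x y H i4 i2 i1] bracket_equation_swap34[of x y H i1 i2 i4 i3])
  qed
qed

lemma bracket_equations_if_collinear:
  assumes "proj_collinear (range x)"
  shows "all_bracket_equations x y H"
  using assms by (simp add: proj_collinear_iff_brackets all_bracket_equations_def bracket_equation_def)

lemma noncollinear_basis:
  fixes x :: "5 \<Rightarrow> complex^3"
  assumes "\<not> proj_collinear (range x)"
  obtains a b c d e where "bracket3 (x a) (x b) (x c) \<noteq> 0" "distinct [a, b, c, d, e]"
proof -
  obtain a b c where abc: "bracket3 (x a) (x b) (x c) \<noteq> 0"
    using assms by (auto simp: proj_collinear_iff_brackets)
  then have "distinct [a, b, c]" by auto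
  then obtain d e where "distinct [a, b, c, d, e]"
    using complete_distinct_triple by blast
  with abc show ?thesis by (rule that)
qed

text \<open>
  Take a line through \<open>y d\<close> and \<open>y e\<close>. Combining its equation with the functional
  \<open>[\<cdot> b c]\<^sub>x\<close> leaves the single term \<open>a\<close> of the relation, so \<open>y a\<close> is on the line as well;
  likewise for \<open>y b\<close> and \<open>y c\<close>.
\<close>

lemma collinear_if_relation:
  fixes x y :: "5 \<Rightarrow> complex^3"
  assumes rel: "kronecker_relation w x y" and nz: "\<And>i. w i \<noteq> 0"
    and x: "\<not> proj_collinear (range x)"
  shows "proj_collinear (range y)"
proof -
  obtain a b c d e where abc: "bracket3 (x a) (x b) (x c) \<noteq> 0"
      and dist: "distinct [a, b, c, d, e]"
    using x by (rule noncollinear_basis)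
  obtain l where l: "l \<noteq> 0" "(\<Sum>k\<in>UNIV. l $ k * y d $ k) = 0" "(\<Sum>k\<in>UNIV. l $ k * y e $ k) = 0"
    by (rule annihilator_of_two_exists)
  have bca: "bracket3 (x b) (x c) (x a) \<noteq> 0" and cab: "bracket3 (x c) (x a) (x b) \<noteq> 0"
    using abc by (simp_all add: bracket3_expand algebra_simps)
  have sum0: "(\<Sum>i\<in>UNIV. w i * bracket3 (x i) u v * (\<Sum>k\<in>UNIV. l $ k * y i $ k)) = 0" for u v
    unfolding bracket3_functional by (rule kronecker_relation_functionals[OF rel])
  have "(\<Sum>k\<in>UNIV. l $ k * y a $ k) = 0"
    using sum0[of "x b" "x c"] abc nz l by (simp add: sum_five[OF dist])
  moreover have "(\<Sum>k\<in>UNIV. l $ k * y b $ k) = 0"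
    using sum0[of "x c" "x a"] bca nz l by (simp add: sum_five[OF dist])
  moreover have "(\<Sum>k\<in>UNIV. l $ k * y c $ k) = 0"
    using sum0[of "x a" "x b"] cab nz l by (simp add: sum_five[OF dist])
  ultimately have "y i \<in> proj_line l" for i
    using l distinct_five_UNIV[OF dist] by (auto simp: proj_line_def)
  with l(1) show ?thesis
    by (auto simp: proj_collinear_def)
qed

text \<open>
  In the basis \<open>x a, x b, x c\<close> the relation splits into three equations between vectors of \<open>\<complex>\<^sup>2\<close>,
  one for each \<open>m \<in> {a, b, c}\<close>: the \<open>m\<close>-th coordinate of the contribution of \<open>d\<close> and \<open>e\<close> has to be cancelled
  by a multiple of \<open>y m\<close>. Bracketing with \<open>y m\<close> turns this into
  \<open>s * f m + t * g m = 0\<close>, a system whose minors vanish by the bracket equations.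
\<close>

lemma relation_if_bracket_equations:
  assumes x: "\<not> proj_collinear (range x)"
    and y: "\<And>i. to_P1 H (y i) \<noteq> 0"
    and eqs: "all_bracket_equations x y H"
  obtains c where "\<exists>i. c i \<noteq> 0" "kronecker_relation c x (\<lambda>i. to_P1 H (y i))"
proof -
  obtain a b c d e where abc: "bracket3 (x a) (x b) (x c) \<noteq> 0"
      and dist: "distinct [a, b, c, d, e]"
    using x by (rule noncollinear_basis)
  define \<eta> where "\<eta> = (\<lambda>i. to_P1 H (y i))"
  define Q where "Q = (\<lambda>i j. bracket2 (\<eta> i) (\<eta> j))"
  \<comment> \<open>By Cramer's rule, \<open>coord m p\<close> is the coordinate of \<open>p\<close> along \<open>x m\<close>, multiplied by \<open>[a b c]\<close>.\<close>
  define coord where "coord = (\<lambda>m p. if m = a then bracket3 p (x b) (x c)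
      else if m = b then bracket3 p (x c) (x a) else bracket3 p (x a) (x b))"
  have coord: "coord a p = bracket3 p (x b) (x c)" "coord b p = bracket3 p (x c) (x a)"
      "coord c p = bracket3 p (x a) (x b)" for p
    using dist by (auto simp: coord_def)
  have as_coord: "bracket3 p (x b) (x c) = coord a p" "bracket3 p (x c) (x b) = - coord a p"
      "bracket3 p (x c) (x a) = coord b p" "bracket3 p (x a) (x c) = - coord b p"
      "bracket3 p (x a) (x b) = coord c p" "bracket3 p (x b) (x a) = - coord c p" for p
    unfolding coord using bracket3_swap(2) by blast+
  have eq: "bracket3 (x i1) (x i3) (x j) * bracket3 (x i2) (x i4) (x j) * Q i1 i4 * Q i2 i3 =
      bracket3 (x i1) (x i4) (x j) * bracket3 (x i2) (x i3) (x j) * Q i1 i3 * Q i2 i4"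
    if "distinct [i1, i2, i3, i4, j]" for i1 i2 i3 i4 j
    using eqs that unfolding all_bracket_equations_def bracket_equation_def Q_def \<eta>_def by blast
  define f g where "f = (\<lambda>m. coord m (x d) * Q d m)" and "g = (\<lambda>m. coord m (x e) * Q e m)"
  have reordered: "distinct [d, e, a, b, c]" "distinct [d, e, a, c, b]" "distinct [d, e, b, c, a]"
    using dist by auto
  \<comment> \<open>The minor of two rows of \<open>{a, b, c}\<close> is the equation whose \<open>j\<close> is the third index.\<close>
  have "f a * g b = f b * g a"
    using eq[OF reordered(1)] by (simp add: f_def g_def as_coord mult_ac)
  moreover have "f a * g c = f c * g a"
    using eq[OF reordered(2)] by (simp add: f_def g_def as_coord mult_ac)
  moreover have "f b * g c = f c * g b"
    using eq[OF reordered(3)] by (simp add: f_def g_def as_coord mult_ac)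
  ultimately have minors: "f k * g m = f m * g k" if "k \<in> {a, b, c}" "m \<in> {a, b, c}" for k m
    using that by auto
  obtain s t where st: "s \<noteq> 0 \<or> t \<noteq> 0" "\<And>m. m \<in> {a, b, c} \<Longrightarrow> s * f m + t * g m = 0"
    using common_kernel_if_minors_zero[of "{a, b, c}" f g, OF minors] by blast
  have "\<exists>r. (s * coord m (x d)) *s \<eta> d + (t * coord m (x e)) *s \<eta> e = r *s \<eta> m"
    if "m \<in> {a, b, c}" for m
  proof (rule parallel_if_bracket2_zero)
    show "bracket2 ((s * coord m (x d)) *s \<eta> d + (t * coord m (x e)) *s \<eta> e) (\<eta> m) = 0"
      using st(2)[OF that] by (simp add: f_def g_def Q_def bracket2_expand algebra_simps)
    show "\<eta> m \<noteq> 0" using y by (simp add: \<eta>_def)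
  qed blast
  then obtain r where r: "\<And>m. m \<in> {a, b, c} \<Longrightarrow>
      (s * coord m (x d)) *s \<eta> d + (t * coord m (x e)) *s \<eta> e = r m *s \<eta> m"
    by metis
  define D where "D = bracket3 (x a) (x b) (x c)"
  \<comment> \<open>The division by \<open>D\<close> compensates the factor \<open>[a b c]\<close> contained in \<open>coord\<close>.\<close>
  define w where "w = (\<lambda>i. if i = d then s else if i = e then t else - r i / D)"
  have w: "w d = s" "w e = t" "w a = - r a / D" "w b = - r b / D" "w c = - r c / D"
    using dist by (auto simp: w_def)
  have "kronecker_relation w x \<eta>"
    unfolding kronecker_relation_def
  proof (intro allI)
    fix k l
    have cramer: "D * p $ k = coord a p * x a $ k + coord b p * x b $ k + coord c p * x c $ k" for p
      using bracket3_cramer[of "x a" "x b" "x c" p]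
      unfolding D_def coord by (simp add: vec_eq_iff)
    have r': "s * coord m (x d) * \<eta> d $ l + t * coord m (x e) * \<eta> e $ l = r m * \<eta> m $ l"
      if "m \<in> {a, b, c}" for m
      using arg_cong[OF r[OF that], of "\<lambda>v. v $ l"] by simp
    have "D * (\<Sum>i\<in>UNIV. w i * x i $ k * \<eta> i $ l) =
        - (x a $ k * (r a * \<eta> a $ l) + x b $ k * (r b * \<eta> b $ l) + x c $ k * (r c * \<eta> c $ l))
        + s * (D * x d $ k) * \<eta> d $ l + t * (D * x e $ k) * \<eta> e $ l"
      using abc unfolding sum_five[OF dist] w D_def[symmetric] by (simp add: field_simps)
    also have "\<dots> = 0"
      unfolding cramer r'[symmetric, of a, simplified] r'[symmetric, of b, simplified]
        r'[symmetric, of c, simplified]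
      by (simp add: algebra_simps)
    finally show "(\<Sum>i\<in>UNIV. w i * x i $ k * \<eta> i $ l) = 0"
      using abc by (simp add: D_def)
  qed
  moreover have "\<exists>i. w i \<noteq> 0"
    using st(1) w(1,2) by metis
  ultimately show ?thesis
    using that unfolding \<eta>_def by blast
qed

text \<open>
  In charts of both lines the products \<open>x i \<otimes> y i\<close> are five vectors in a space of dimension four.
\<close>

lemma relation_if_both_collinear:
  fixes x y :: "5 \<Rightarrow> complex^3"
  assumes "line_chart Hx (range x)" "line_chart Hy (range y)"
  obtains c where "\<exists>i. c i \<noteq> 0" "kronecker_relation c x y"
proof -
  have "rank (\<chi> i. kronecker (to_P1 Hx (x i)) (to_P1 Hy (y i)) :: complex^(2 \<times> 2)^5) < CARD(5)"
    by (rule le_less_trans[OF rank_le_ncols]) simp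
  then obtain c where c: "\<exists>i. c i \<noteq> 0"
      "kronecker_relation c (\<lambda>i. to_P1 Hx (x i)) (\<lambda>i. to_P1 Hy (y i))"
    unfolding rank_less_iff_rows_dependent rows_dependent_kronecker by blast
  from c(2) have "kronecker_relation c y (\<lambda>i. to_P1 Hx (x i))"
    unfolding kronecker_relation_chart[OF assms(2), symmetric] by (rule kronecker_relation_commute[THEN iffD1])
  then have "kronecker_relation c x y"
    unfolding kronecker_relation_chart[OF assms(1), symmetric] by (rule kronecker_relation_commute[THEN iffD1])
  with c(1) show ?thesis
    by (rule that)
qed

lemma relation_if_collinear_and_bracket_equations:
  fixes x y :: "5 \<Rightarrow> complex^3"
  assumes y_nonzero: "\<And>i. y i \<noteq> 0"
    and chart_x: "proj_collinear (range x) \<Longrightarrow> line_chart Hx (range x)"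
    and chart_y: "line_chart Hy (range y)"
    and eqs: "all_bracket_equations x y Hy"
  obtains c where "\<exists>i. c i \<noteq> 0" "kronecker_relation c x y"
proof (cases "proj_collinear (range x)")
  case True
  then show ?thesis
    using relation_if_both_collinear[OF chart_x chart_y] that by blast
next
  case False
  have "to_P1 Hy (y i) \<noteq> 0" for i
    by (rule to_P1_nonzero[OF chart_y]) (simp_all add: y_nonzero)
  from relation_if_bracket_equations[OF False this eqs] show ?thesis
    using that kronecker_relation_chart[OF chart_y] by blast
qed

lemma bracket_equation_iff_cross_ratio:
  assumes "bracket3 (x i1) (x i4) (x j) \<noteq> 0" "bracket3 (x i2) (x i3) (x j) \<noteq> 0"
    and "bracket2 (to_P1 H (y i1)) (to_P1 H (y i4)) \<noteq> 0" "bracket2 (to_P1 H (y i2)) (to_P1 H (y i3)) \<noteq> 0"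
  shows "bracket_equation x y H i1 i2 i3 i4 j \<longleftrightarrow>
     planar_cross_ratio (x i1) (x i2) (x i3) (x i4) (x j) =
     cross_ratio (to_P1 H (y i1)) (to_P1 H (y i2)) (to_P1 H (y i3)) (to_P1 H (y i4))"
  using assms unfolding bracket_equation_def planar_cross_ratio_def cross_ratio_def
  by (simp add: frac_eq_eq mult_ac)

section \<open>Rank deficiency of five points\<close>

lemma rank_deficient_iff:
  fixes x y :: "5 \<Rightarrow> complex^3"
  assumes x_nonzero: "\<And>i. x i \<noteq> 0"
    and y_nonzero: "\<And>i. y i \<noteq> 0"
    and chart_x: "proj_collinear (range x) \<Longrightarrow> line_chart Hx (range x)"
    and chart_y: "proj_collinear (range y) \<Longrightarrow> line_chart Hy (range y)"
  shows "rank (Z_matrix x y) < 5 \<longleftrightarrow>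
            inherited_condition (Z_matrix x y) \<or>
            (proj_collinear (range y) \<and> all_bracket_equations x y Hy) \<or>
            (proj_collinear (range x) \<and> all_bracket_equations y x Hx)"
    (is "_ \<longleftrightarrow> ?I \<or> ?Y \<or> ?X")
proof -
  have rank: "rank (Z_matrix x y) < 5 \<longleftrightarrow> (\<exists>c. (\<exists>i. c i \<noteq> 0) \<and> kronecker_relation c x y)"
    using rank_less_iff_rows_dependent[of "Z_matrix x y"]
    by (simp add: Z_matrix_def rows_dependent_kronecker)
  have inherited: "?I \<longleftrightarrow> (\<exists>c. (\<exists>i. c i \<noteq> 0) \<and> (\<exists>i. c i = 0) \<and> kronecker_relation c x y)"
    by (simp add: Z_matrix_def inherited_condition_kronecker)
  show ?thesis
  proof
    assume "rank (Z_matrix x y) < 5"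
    then obtain c where c: "\<exists>i. c i \<noteq> 0" "kronecker_relation c x y"
      unfolding rank by blast
    show "?I \<or> ?Y \<or> ?X"
    proof (cases "\<exists>i. c i = 0")
      case True
      with c inherited show ?thesis by blast
    next
      case False
      then have nz: "\<And>i. c i \<noteq> 0" by blast
      have c': "kronecker_relation c y x"
        using c(2) by (rule kronecker_relation_commute[THEN iffD1])
      consider "proj_collinear (range y)" | "proj_collinear (range x)"
        using collinear_if_relation[OF c(2) nz] by blast
      then show ?thesis
      proof cases
        case 1
        have "all_bracket_equations x y Hy"
          using c(2) nz unfolding kronecker_relation_chart[OF chart_y[OF 1]]
          by (rule bracket_equations_if_relation)
        with 1 show ?thesis by blast
      next
        case 2
        have "all_bracket_equations y x Hx"
          using c' nz unfolding kronecker_relation_chart[OF chart_x[OF 2]]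
          by (rule bracket_equations_if_relation)
        with 2 show ?thesis by blast
      qed
    qed
  next
    assume "?I \<or> ?Y \<or> ?X"
    then show "rank (Z_matrix x y) < 5"
    proof (elim disjE conjE)
      assume ?I
      with rank inherited show ?thesis by blast
    next
      assume "proj_collinear (range y)" "all_bracket_equations x y Hy"
      from relation_if_collinear_and_bracket_equations[OF y_nonzero chart_x chart_y[OF this(1)] this(2)] show ?thesis
        unfolding rank by blast
    next
      assume "proj_collinear (range x)" "all_bracket_equations y x Hx"
      from relation_if_collinear_and_bracket_equations[OF x_nonzero chart_y chart_x[OF this(1)] this(2)] show ?thesis
        unfolding rank kronecker_relation_commute[of _ x y] by blast
    qed
  qed
qed

theorem theorem5p1:
  fixes x y :: "5 \<Rightarrow> complex^3"
    and Hx Hy :: "complex^3^3"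
  assumes x_nonzero: "\<And>i. x i \<noteq> 0"
    and y_nonzero: "\<And>i. y i \<noteq> 0"
    and chart_x: "proj_collinear (range x) \<Longrightarrow> line_chart Hx (range x)"
    and chart_y: "proj_collinear (range y) \<Longrightarrow> line_chart Hy (range y)"
  shows "(rank (Z_matrix x y) < 5 \<longleftrightarrow>
            inherited_condition (Z_matrix x y) \<or>
            (proj_collinear (range y) \<and> all_bracket_equations x y Hy) \<or>
            (proj_collinear (range x) \<and> all_bracket_equations y x Hx))
    \<and> (proj_collinear (range y) \<longrightarrow>
         (\<forall>i1 i2 i3 i4 k1 k2 k3 k4 j.
            distinct [i1, i2, i3, i4, j] \<longrightarrow> distinct [k1, k2, k3, k4, j] \<longrightarrow>
            (bracket_equation x y Hy i1 i2 i3 i4 j \<longleftrightarrow> bracket_equation x y Hy k1 k2 k3 k4 j)))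
    \<and> (proj_collinear (range x) \<longrightarrow> proj_collinear (range y) \<longrightarrow> all_bracket_equations x y Hy)
    \<and> (proj_collinear (range y) \<longrightarrow>
         (\<forall>i j l. distinct [i, j, l] \<longrightarrow> \<not> proj_collinear {x i, x j, x l}) \<longrightarrow>
         (\<forall>i j. i \<noteq> j \<longrightarrow> \<not> proj_eq (y i) (y j)) \<longrightarrow>
         (\<forall>i1 i2 i3 i4 j. distinct [i1, i2, i3, i4, j] \<longrightarrow>
            (bracket_equation x y Hy i1 i2 i3 i4 j \<longleftrightarrow>
             planar_cross_ratio (x i1) (x i2) (x i3) (x i4) (x j) =
             cross_ratio (to_P1 Hy (y i1)) (to_P1 Hy (y i2)) (to_P1 Hy (y i3)) (to_P1 Hy (y i4)))))"
  proof (intro conjI impI allI)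
  show "rank (Z_matrix x y) < 5 \<longleftrightarrow>
            inherited_condition (Z_matrix x y) \<or>
            (proj_collinear (range y) \<and> all_bracket_equations x y Hy) \<or>
            (proj_collinear (range x) \<and> all_bracket_equations y x Hx)"
    using assms by (rule rank_deficient_iff)
next
  fix i1 i2 i3 i4 k1 k2 k3 k4 j :: 5
  assume "distinct [i1, i2, i3, i4, j]" "distinct [k1, k2, k3, k4, j]"
  then show "bracket_equation x y Hy i1 i2 i3 i4 j \<longleftrightarrow> bracket_equation x y Hy k1 k2 k3 k4 j"
    by (rule bracket_equation_permute)
next
  assume "proj_collinear (range x)"
  then show "all_bracket_equations x y Hy"
    by (rule bracket_equations_if_collinear)
next
  fix i1 i2 i3 i4 j :: 5
  assume y: "proj_collinear (range y)"
    and x_generic: "\<forall>i j l. distinct [i, j, l] \<longrightarrow> \<not> proj_collinear {x i, x j, x l}"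
    and y_distinct: "\<forall>i j. i \<noteq> j \<longrightarrow> \<not> proj_eq (y i) (y j)"
    and dist: "distinct [i1, i2, i3, i4, j]"
  have "bracket3 (x i) (x k) (x l) \<noteq> 0" if "distinct [i, k, l]" for i k l
    by (intro bracket3_nonzero_if_not_collinear) (use x_generic that in blast)
  moreover have "bracket2 (to_P1 Hy (y i)) (to_P1 Hy (y k)) \<noteq> 0" if "i \<noteq> k" for i k
    by (rule bracket2_to_P1_nonzero[OF chart_y[OF y]]) (use that y_nonzero y_distinct in auto)
  ultimately show "bracket_equation x y Hy i1 i2 i3 i4 j \<longleftrightarrow>
      planar_cross_ratio (x i1) (x i2) (x i3) (x i4) (x j) =
      cross_ratio (to_P1 Hy (y i1)) (to_P1 Hy (y i2)) (to_P1 Hy (y i3)) (to_P1 Hy (y i4))"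
    using dist by (intro bracket_equation_iff_cross_ratio) auto
qed

end
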